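(* Let $Z\subseteq\{0,1\}^n$ and let $Q=FF^\top$, where $F\in\mathbb{R}^{n\times k}$ is a matrix of full column rank satisfying $$\operatorname{col}(F)=\bigcap_{\hat{\mathbf{e}}_S\in Z}\pi_S^{-1}(\operatorname{col}(F_S)).$$ Then $$\operatorname{cl\,conv}(X)=\left\{(x,z,t)\in\mathbb{R}^n\times[0,1]^n\times\mathbb{R}\;:\;\exists\, W\in\mathbb{R}^{k\times k}\text{ such that }\begin{pmatrix}W & F^\top x \\ x^\top F & t\end{pmatrix}\succeq 0\ \text{ and }\ (z,W)\in P_F\right\}.$$
   Context: $\operatorname{cl\,conv}$ denotes the closure of the convex hull. Let $\mathbf{e}$ be the all-ones vector in $\mathbb{R}^n$ and $\circ$ the Hadamard (entrywise) product. Set $$X=\{(x,z,t)\in\mathbb{R}^n\times Z\times\mathbb{R}: t\ge x^\top Qx,\ x\circ(\mathbf{e}-z)=0\}.$$ For $S\subseteq[n]=\{1,\dots,n\}$: $\hat{\mathbf{e}}_S\in\{0,1\}^n$ is the indicator vector of $S$; $F_S\in\mathbb{R}^{S\times k}$ is the submatrix of $F$ consisting of the rows indexed by $S$; $\hat F_S\in\mathbb{R}^{n\times k}$ is obtained from $F_S$ by filling in the missing rows with zeros; $\pi_S:\mathbb{R}^n\to\mathbb{R}^S$ is the coordinate projection onto the coordinates in $S$, and $\pi_S^{-1}(\cdot)$ denotes preimage under $\pi_S$. $\operatorname{col}(\cdot)$ denotes the column space and $A^\dagger$ the Moore–Penrose pseudoinverse of $A$. The polytope $P_F\subseteq\mathbb{R}^{n+k^2}$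 is $$P_F=\operatorname{conv}\{(\hat{\mathbf{e}}_S,\hat F_S^\dagger\hat F_S): \hat{\mathbf{e}}_S\in Z\}.$$ $M\succeq 0$ means that $M$ is symmetric positive semidefinite. *)

theory Defs
  imports "HOL-Analysis.Analysis"
begin

definition is_pinv :: "real^'k^'n \<Rightarrow> real^'n^'k \<Rightarrow> bool" where
  "is_pinv A B \<longleftrightarrow>
     A ** B ** A = A \<and> B ** A ** B = B \<and>
     transpose (A ** B) = A ** B \<and> transpose (B ** A) = B ** A"

definition pinv :: "real^'k^'n \<Rightarrow> real^'n^'k" where
  "pinv A = (THE B. is_pinv A B)"

text \<open>The four Penrose equations have exactly one solution, so the definite description in
  \<open>pinv\<close> is well defined. For existence, solve the normal equations of \<open>A\<close> and of its transpose.\<close>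

lemma is_pinv_unique:
  fixes A :: "real^'k^'n"
  assumes "is_pinv A B" "is_pinv A C"
  shows "B = C"
proof -
  have B: "A ** B ** A = A" "B ** A ** B = B"
          "transpose (A ** B) = A ** B" "transpose (B ** A) = B ** A"
   and C: "A ** C ** A = A" "C ** A ** C = C"
          "transpose (A ** C) = A ** C" "transpose (C ** A) = C ** A"
    using assms by (auto simp: is_pinv_def)
  have "A ** B = transpose (A ** C ** A ** B)"
    by (simp add: B C)
  also have "\<dots> = transpose (A ** B) ** transpose (A ** C)"
    by (simp add: matrix_transpose_mul matrix_mul_assoc)
  also have "\<dots> = A ** C"
    by (simp add: B C matrix_mul_assoc)
  finally have AB: "A ** B = A ** C" .
  have "B ** A = transpose (B ** A ** C ** A)"
    by (metis B(4) C(1) matrix_mul_assoc)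
  also have "\<dots> = transpose (C ** A) ** transpose (B ** A)"
    by (simp add: matrix_transpose_mul matrix_mul_assoc)
  also have "\<dots> = C ** A"
    by (metis B C matrix_mul_assoc)
  finally have BA: "B ** A = C ** A" .
  show ?thesis
    by (metis AB BA B(2) C(2) matrix_mul_assoc)
qed

lemma normal_equations_solvable:
  fixes A :: "real^'k^'n"
  obtains Y :: "real^'n^'k"
  where "transpose A ** A ** Y = transpose A"
proof -
  have "\<exists>c. (transpose A ** A) *v c = transpose A *v b" for b
  proof -
    have sp: "span (range ((*v) A)) = range ((*v) A)"
      by (simp add: linear_subspace_image span_eq_iff)
    obtain y z where y: "y \<in> range ((*v) A)"
      and z: "\<And>w. w \<in> range ((*v) A) \<Longrightarrow> orthogonal z w" and b: "b = y + z"
      using orthogonal_subspace_decomp_exists[of "range ((*v) A)" b] unfolding sp by blast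
    have "transpose A *v z = 0"
    proof -
      have "(transpose A *v z) \<bullet> (transpose A *v z) = z \<bullet> (A *v (transpose A *v z))"
        by (simp add: dot_lmul_matrix[symmetric] inner_commute)
      also have "\<dots> = 0"
        using z by (auto simp: orthogonal_def)
      finally show ?thesis by simp
    qed
    moreover obtain c where "y = A *v c" using y by blast
    ultimately show ?thesis
      using b by (auto simp: matrix_vector_right_distrib matrix_vector_mul_assoc)
  qed
  then obtain f where f: "\<And>b. (transpose A ** A) *v f b = transpose A *v b"
    by metis
  define Y :: "real^'n^'k" where "Y = (\<chi> i j. f (axis j 1) $ i)"
  have "Y *v axis j 1 = f (axis j 1)" for j
    by (simp add: Y_def matrix_vector_mul_component vec_eq_iff inner_axis)
  then have "(transpose A ** A ** Y) *v axis j 1 = transpose A *v axis j 1" for j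
    by (metis f matrix_vector_mul_assoc)
  then have "column j (transpose A ** A ** Y) = column j (transpose A)" for j
    by (metis matrix_vector_mult_basis)
  then have "transpose A ** A ** Y = transpose A"
    by (simp add: column_def vec_eq_iff)
  then show thesis by (rule that)
qed

lemma symmetric_inner_inverse:
  fixes A :: "real^'k^'n"
  obtains Y where "A ** Y ** A = A" "transpose (A ** Y) = A ** Y"
proof -
  obtain Y where Y: "transpose A ** A ** Y = transpose A"
    by (rule normal_equations_solvable)
  have "transpose (A ** Y) ** (A ** Y) = transpose (A ** Y)"
    by (metis Y matrix_mul_assoc matrix_transpose_mul)
  then have sym: "transpose (A ** Y) = A ** Y"
    by (metis matrix_transpose_mul transpose_transpose)
  have "transpose (A ** Y) ** A = A"
    by (metis Y matrix_mul_assoc matrix_transpose_mul transpose_transpose)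
  with sym show thesis by (intro that[of Y]) simp_all
qed

lemma is_pinv_exists:
  fixes A :: "real^'k^'n"
  shows "\<exists>B. is_pinv A B"
proof -
  obtain Y where Y: "A ** Y ** A = A" "transpose (A ** Y) = A ** Y"
    by (rule symmetric_inner_inverse)
  obtain V where V: "transpose A ** V ** transpose A = transpose A"
      "transpose (transpose A ** V) = transpose A ** V"
    by (rule symmetric_inner_inverse)
  define U where "U = transpose V"
  have U1: "A ** U ** A = A"
    unfolding U_def by (metis V(1) matrix_mul_assoc matrix_transpose_mul transpose_transpose)
  have U2: "transpose (U ** A) = U ** A"
    unfolding U_def by (metis V(2) matrix_transpose_mul transpose_transpose)
  have AB: "A ** (U ** A ** Y) = A ** Y"
    by (simp add: matrix_mul_assoc U1)
  have BA: "U ** A ** Y ** A = U ** A"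
    by (metis matrix_mul_assoc Y(1))
  have "U ** A ** Y ** A ** (U ** A ** Y) = U ** A ** Y"
    by (metis AB BA matrix_mul_assoc)
  then have "is_pinv A (U ** A ** Y)"
    unfolding is_pinv_def using AB BA Y U2 by simp
  then show ?thesis by blast
qed

lemma is_pinv_pinv: "is_pinv A (pinv A)"
  unfolding pinv_def by (rule theI') (use is_pinv_exists is_pinv_unique in blast)

definition psd :: "real^'m^'m \<Rightarrow> bool" where
  "psd M \<longleftrightarrow> transpose M = M \<and> (\<forall>v. v \<bullet> (M *v v) \<ge> 0)"

text \<open>The square matrix with blocks \<open>W\<close> (top left), the column \<open>u\<close> (top right),
  the row \<open>v\<close> (bottom left) and the scalar \<open>t\<close> (bottom right).\<close>

definition bordered :: "real^'k^'k \<Rightarrow> real^'k \<Rightarrow> real^'k \<Rightarrow> real \<Rightarrow> real^('k + 1)^('k + 1)" where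
  "bordered W u v t =
     (\<chi> a b. case a of
        Inl i \<Rightarrow> (case b of Inl j \<Rightarrow> W $ i $ j | Inr _ \<Rightarrow> u $ i)
      | Inr _ \<Rightarrow> (case b of Inl j \<Rightarrow> v $ j | Inr _ \<Rightarrow> t))"

definition ind_vec :: "'n set \<Rightarrow> real^'n" where
  "ind_vec S = (\<chi> i. if i \<in> S then 1 else 0)"

text \<open>Vectors indexed by a subset \<open>S\<close> of the coordinates are functions that are \<open>undefined\<close>
  outside \<open>S\<close>. Likewise a matrix with rows indexed by \<open>S\<close> is such a function whose values are the
  rows. Function types carry no vector space structure, so its column space is written out as the
  set of linear combinations of the columns.\<close>

definition proj :: "'n set \<Rightarrow> real^'n \<Rightarrow> ('n \<Rightarrow> real)" where
  "proj S x = (\<lambda>i\<in>S. x $ i)"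

definition row_submatrix :: "real^'k^'n \<Rightarrow> 'n set \<Rightarrow> ('n \<Rightarrow> real^'k)" where
  "row_submatrix F S = (\<lambda>i\<in>S. F $ i)"

definition col_on :: "'n set \<Rightarrow> ('n \<Rightarrow> real^'k) \<Rightarrow> ('n \<Rightarrow> real) set" where
  "col_on S A = {\<lambda>i\<in>S. \<Sum>j\<in>UNIV. c j * A i $ j | c. True}"

definition zero_fill :: "'n set \<Rightarrow> ('n \<Rightarrow> real^'k) \<Rightarrow> real^'k^'n" where
  "zero_fill S A = (\<chi> i. if i \<in> S then A i else 0)"

definition F_hat :: "real^'k^'n \<Rightarrow> 'n set \<Rightarrow> real^'k^'n" where
  "F_hat F S = zero_fill S (row_submatrix F S)"

text \<open>On vectors, \<open>*\<close> is the entrywise (Hadamard) product and \<open>1\<close> is the all-ones vector.\<close>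

definition X_set :: "(real^'n) set \<Rightarrow> real^'n^'n \<Rightarrow> ((real^'n) \<times> (real^'n) \<times> real) set" where
  "X_set Z Q = {(x, z, t). z \<in> Z \<and> t \<ge> x \<bullet> (Q *v x) \<and> x * (1 - z) = 0}"

definition P_poly :: "(real^'n) set \<Rightarrow> real^'k^'n \<Rightarrow> ((real^'n) \<times> (real^'k^'k)) set" where
  "P_poly Z F =
     convex hull {(ind_vec S, pinv (F_hat F S) ** F_hat F S) | S. ind_vec S \<in> Z}"

end

theory Submission
  imports Defs
begin

text \<open>Write \<open>N\<^sub>S\<close> for the vectors supported on \<open>S\<close> that are killed by the transpose of \<open>F\<close>, and
  \<open>P\<^sub>S\<close> for the symmetric idempotent \<open>pinv (F_hat F S) ** F_hat F S\<close>. It is the orthogonal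
  projection onto the row space of \<open>F_hat F S\<close>, that is, onto the image of the vectors supported
  on \<open>S\<close> under the transpose of \<open>F\<close>.

  The right-hand side is the linear image of a closed convex set whose \<open>W\<close>-component stays in a
  compact set, so it is closed and convex. It contains \<open>X_set Z Q\<close> (take \<open>W = P\<^sub>S\<close>), hence also
  the closed convex hull.

  Conversely, let \<open>(x, z, t)\<close> and \<open>W\<close> be as on the right and let \<open>u\<close> be the image of \<open>x\<close> under the
  transpose of \<open>F\<close>. Positive semidefiniteness gives \<open>y\<close> with \<open>u = W *v y\<close> and
  \<open>t \<ge> y \<bullet> (W *v y)\<close> (\<open>bordered_psd_range\<close>). With \<open>y\<close> fixed, each vertex \<open>(ind_vec S, P\<^sub>S)\<close> of
  \<open>P_poly Z F\<close> yields a point of \<open>X_set Z Q\<close> whose first component has image \<open>P\<^sub>S *v y\<close> and whose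
  last component is \<open>y \<bullet> (P\<^sub>S *v y)\<close> plus a fixed slack. Averaging these points gives \<open>(x', z, t)\<close> in the convex
  hull, where \<open>x'\<close> has the same image \<open>u\<close> as \<open>x\<close> (\<open>P_poly_lift\<close>).
  The difference \<open>x - x'\<close> lies in the kernel of the transpose of \<open>F\<close>. The hypothesis
  on the column space of \<open>F\<close> says, after passing to orthogonal complements, that this kernel is
  spanned by the \<open>N\<^sub>S\<close> with \<open>ind_vec S \<in> Z\<close> (\<open>kernel_subset_span\<close>). Finally each \<open>d \<in> N\<^sub>S\<close>
  is a recession direction of the closed convex hull, because all the points
  \<open>(c *\<^sub>R d, ind_vec S, 0)\<close> belong to \<open>X_set Z Q\<close>, and hence so is each vector of the span of
  these \<open>N\<^sub>S\<close> (\<open>span_recession\<close>).\<close>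

section \<open>Bordered positive semidefinite matrices\<close>

lemma sum_UNIV_Plus1:
  fixes f :: "'k::finite + 1 \<Rightarrow> real"
  shows "sum f UNIV = (\<Sum>i\<in>UNIV. f (Inl i)) + f (Inr 1)"
proof -
  have "sum f UNIV = sum f (UNIV <+> UNIV)" by (simp only: UNIV_Plus_UNIV)
  also have "\<dots> = (\<Sum>i\<in>UNIV. f (Inl i)) + (\<Sum>i\<in>UNIV. f (Inr i))"
    by (subst sum.Plus) auto
  finally show ?thesis by (simp add: sum_1)
qed

lemma bordered_quadratic_form:
  fixes v :: "real^('k::finite + 1)"
  defines "a \<equiv> (\<chi> i. v $ Inl i)" and "b \<equiv> v $ Inr 1"
  shows "v \<bullet> (bordered W u u t *v v) = a \<bullet> (W *v a) + 2 * b * (a \<bullet> u) + b\<^sup>2 * t"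
  unfolding a_def b_def inner_vec_def matrix_vector_mult_def
  by (simp add: sum_UNIV_Plus1 bordered_def sum.distrib sum_distrib_left sum_distrib_right
      algebra_simps power2_eq_square)

lemma transpose_bordered_eq_iff:
  "transpose (bordered W u u t) = bordered W u u t \<longleftrightarrow> transpose W = W"
proof
  assume "transpose (bordered W u u t) = bordered W u u t"
  then have "transpose (bordered W u u t) $ Inl i $ Inl j = bordered W u u t $ Inl i $ Inl j" for i j
    by simp
  then show "transpose W = W"
    by (simp add: vec_eq_iff transpose_def bordered_def)
next
  assume "transpose W = W"
  then have W: "W $ j $ i = W $ i $ j" for i j
    by (metis transpose_def vec_lambda_beta)
  show "transpose (bordered W u u t) = bordered W u u t"
    by (auto simp: vec_eq_iff transpose_def bordered_def W split: sum.splits)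
qed

lemma psd_bordered_iff:
  "psd (bordered W u u t) \<longleftrightarrow>
     transpose W = W \<and> (\<forall>a b. a \<bullet> (W *v a) + 2 * b * (a \<bullet> u) + b\<^sup>2 * t \<ge> 0)"
  (is "_ \<longleftrightarrow> _ \<and> (\<forall>a b. ?q a b \<ge> 0)")
proof -
  have "(\<forall>v. v \<bullet> (bordered W u u t *v v) \<ge> 0) \<longleftrightarrow> (\<forall>a b. ?q a b \<ge> 0)"
  proof (intro iffI allI)
    fix a b
    assume "\<forall>v. v \<bullet> (bordered W u u t *v v) \<ge> 0"
    then have "(\<chi> s. case s of Inl i \<Rightarrow> a $ i | Inr _ \<Rightarrow> b) \<bullet>
        (bordered W u u t *v (\<chi> s. case s of Inl i \<Rightarrow> a $ i | Inr _ \<Rightarrow> b)) \<ge> 0"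
      by blast
    then show "?q a b \<ge> 0"
      by (subst (asm) bordered_quadratic_form) simp
  qed (simp add: bordered_quadratic_form)
  then show ?thesis
    by (simp add: psd_def transpose_bordered_eq_iff)
qed

lemma inner_matrix_vector_transpose:
  fixes A :: "real^'k^'n"
  shows "w \<bullet> (A *v c) = (transpose A *v w) \<bullet> c"
  by (simp add: dot_lmul_matrix)

text \<open>If the bordered matrix is positive semidefinite, its border is in the range of \<open>W\<close> and the
  generalized Schur complement is nonnegative.\<close>

lemma bordered_psd_range:
  fixes W :: "real^'k^'k"
  assumes "psd (bordered W u u t)"
  obtains y where "u = W *v y" "y \<bullet> (W *v y) \<le> t"
proof -
  have sym: "transpose W = W"
    and q: "\<And>a b. a \<bullet> (W *v a) + 2 * b * (a \<bullet> u) + b\<^sup>2 * t \<ge> 0"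
    using assms by (auto simp: psd_bordered_iff)
  have sp: "span (range ((*v) W)) = range ((*v) W)"
    by (simp add: linear_subspace_image span_eq_iff)
  obtain y r where u: "u = W *v y + r"
    and r: "\<And>w. w \<in> range ((*v) W) \<Longrightarrow> orthogonal r w"
    using orthogonal_subspace_decomp_exists[of "range ((*v) W)" u] unfolding sp by blast
  have rW: "r \<bullet> (W *v c) = 0" for c
    using r by (auto simp: orthogonal_def)
  have ru: "r \<bullet> u = r \<bullet> r"
    by (simp add: u inner_add_right rW)
  have "r = 0"
  proof (rule ccontr)
    assume "r \<noteq> 0"
    then have pos: "r \<bullet> r > 0" by simp
    \<comment> \<open>Since \<open>r \<bullet> (W *v r) = 0\<close>, the form at \<open>(s *\<^sub>R r, 1)\<close> is affine in \<open>s\<close>, and this \<open>s\<close> makes it \<open>-1\<close>.\<close>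
    define s where "s = - (t + 1) / (2 * (r \<bullet> r))"
    have "(s *\<^sub>R r) \<bullet> (W *v (s *\<^sub>R r)) + 2 * 1 * ((s *\<^sub>R r) \<bullet> u) + 1\<^sup>2 * t \<ge> 0"
      by (rule q)
    then have "2 * s * (r \<bullet> r) + t \<ge> 0"
      by (simp add: rW ru matrix_vector_mult_scaleR)
    moreover have "2 * s * (r \<bullet> r) = - (t + 1)"
      using pos by (simp add: s_def)
    ultimately show False by simp
  qed
  then have uy: "u = W *v y" using u by simp
  have "y \<bullet> (W *v y) \<le> t"
    using q[of y "-1"] by (simp add: uy)
  with uy show thesis by (rule that)
qed

section \<open>The orthogonal projections attached to index sets\<close>

text \<open>The Hadamard product with \<open>ind_vec S\<close> replaces the coordinates outside \<open>S\<close> by zero.\<close>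

lemma F_hat_mult_vec: "F_hat F S *v c = ind_vec S * (F *v c)"
  by (auto simp: vec_eq_iff F_hat_def zero_fill_def row_submatrix_def ind_vec_def
      matrix_vector_mult_def)

lemma inner_ind_vec_mult: "(ind_vec S * v) \<bullet> w = v \<bullet> (ind_vec S * w)"
  by (simp add: inner_vec_def mult_ac)

lemma transpose_F_hat_mult_vec: "transpose (F_hat F S) *v w = transpose F *v (ind_vec S * w)"
proof (rule vector_eq_rdot[THEN iffD1], rule allI)
  fix c
  show "(transpose (F_hat F S) *v w) \<bullet> c = (transpose F *v (ind_vec S * w)) \<bullet> c"
    by (simp only: inner_matrix_vector_transpose[symmetric] F_hat_mult_vec inner_ind_vec_mult)
qed

text \<open>The matrix \<open>pinv A ** A\<close> is the orthogonal projection onto the row space of \<open>A\<close>.\<close>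

lemma pinv_mult_self:
  fixes A :: "real^'k^'n"
  defines "P \<equiv> pinv A ** A"
  shows transpose_pinv_mult_self: "transpose P = P"
    and pinv_mult_self_idem: "P *v (P *v y) = P *v y"
    and pinv_mult_self_transpose: "P *v (transpose A *v w) = transpose A *v w"
    and pinv_mult_self_range: "P *v y = transpose A *v (transpose (pinv A) *v y)"
proof -
  have A: "A ** pinv A ** A = A" "pinv A ** A ** pinv A = pinv A"
    and sym: "transpose P = P"
    using is_pinv_pinv[of A] by (auto simp: is_pinv_def P_def)
  show "transpose P = P" by (fact sym)
  have "P ** P = P"
    unfolding P_def by (metis A matrix_mul_assoc)
  then show "P *v (P *v y) = P *v y"
    by (simp add: matrix_vector_mul_assoc)
  have "P ** transpose A = transpose (A ** P)"
    by (simp only: matrix_transpose_mul sym)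
  also have "A ** P = A"
    by (simp add: P_def matrix_mul_assoc A)
  finally show "P *v (transpose A *v w) = transpose A *v w"
    by (simp only: matrix_vector_mul_assoc)
  have "P = transpose A ** transpose (pinv A)"
    using sym by (simp only: P_def matrix_transpose_mul)
  then show "P *v y = transpose A *v (transpose (pinv A) *v y)"
    by (simp only: matrix_vector_mul_assoc)
qed

text \<open>A symmetric idempotent bordered by a vector of its range has the squared norm of that vector
  as the threshold for positive semidefiniteness.\<close>

lemma psd_bordered_projection:
  assumes sym: "transpose P = P" and idem: "\<And>y. P *v (P *v y) = P *v y"
    and u: "P *v u = u" and t: "u \<bullet> u \<le> t"
  shows "psd (bordered P u u t)"
  unfolding psd_bordered_iff
proof (intro conjI allI sym)
  fix a b
  have aP: "a \<bullet> (P *v c) = (P *v a) \<bullet> c" for c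
    using sym by (simp only: inner_matrix_vector_transpose)
  have au: "a \<bullet> u = (P *v a) \<bullet> u"
    using aP[of u] u by simp
  have aa: "a \<bullet> (P *v a) = (P *v a) \<bullet> (P *v a)"
    using aP[of "P *v a"] idem by simp
  have "0 \<le> (P *v a + b *\<^sub>R u) \<bullet> (P *v a + b *\<^sub>R u)"
    by simp
  also have "\<dots> = a \<bullet> (P *v a) + 2 * b * (a \<bullet> u) + b\<^sup>2 * (u \<bullet> u)"
    by (simp add: au aa inner_add_left inner_add_right power2_eq_square inner_commute)
  also have "\<dots> \<le> a \<bullet> (P *v a) + 2 * b * (a \<bullet> u) + b\<^sup>2 * t"
    by (simp add: t mult_left_mono)
  finally show "0 \<le> a \<bullet> (P *v a) + 2 * b * (a \<bullet> u) + b\<^sup>2 * t" .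
qed

section \<open>The closed convex right-hand side\<close>

lemma compact_P_poly: "compact (P_poly Z (F :: real^'k^'n))"
proof -
  have "{(ind_vec S, pinv (F_hat F S) ** F_hat F S) | S. ind_vec S \<in> Z}
      \<subseteq> range (\<lambda>S. (ind_vec S, pinv (F_hat F S) ** F_hat F S))"
    by auto
  then have "finite {(ind_vec S, pinv (F_hat F S) ** F_hat F S) | S. ind_vec S \<in> Z}"
    by (rule finite_subset) simp
  then show ?thesis
    unfolding P_poly_def by (rule finite_imp_compact_convex_hull)
qed

lemma P_poly_box:
  assumes "(z, W) \<in> P_poly Z F"
  shows "z $ i \<in> {0..1}"
proof -
  let ?C = "fst -` {z::real^'a. z $ i \<in> {0..1}} :: ((real^'a) \<times> (real^'b^'b)) set"
  have "convex {z::real^'a. z $ i \<in> {0..1}}"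
    using convex_Int[OF convex_halfspace_ge[of 0 "axis i (1::real)"]
        convex_halfspace_le[of "axis i (1::real)" 1]]
    by (simp add: inner_axis' inner_real_def Int_def conj_commute)
  then have "convex ?C"
    by (intro convex_linear_vimage) (simp_all add: linear_fst)
  then have "P_poly Z F \<subseteq> ?C"
    unfolding P_poly_def by (intro hull_minimal) (auto simp: ind_vec_def)
  with assms show ?thesis by auto
qed

text \<open>The right-hand side before the projection that forgets the matrix \<open>W\<close>.\<close>

definition lifted_set ::
  "(real^'n) set \<Rightarrow> real^'k^'n \<Rightarrow> ((real^'k^'k) \<times> (real^'n) \<times> (real^'n) \<times> real) set" where
  "lifted_set Z F = {(W, x, z, t). psd (bordered W (transpose F *v x) (transpose F *v x) t)
     \<and> (z, W) \<in> P_poly Z F}"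

lemma lifted_set_closed_convex:
  fixes F :: "real^'k^'n"
  shows "closed (lifted_set Z F)" and "convex (lifted_set Z F)"
proof -
  define f where "f a b = (\<lambda>q :: (real^'k^'k) \<times> (real^'n) \<times> (real^'n) \<times> real.
      a \<bullet> (fst q *v a) + 2 * b * (a \<bullet> (transpose F *v fst (snd q))) + b\<^sup>2 * snd (snd (snd q)))"
    for a b
  define g where "g = (\<lambda>q :: (real^'k^'k) \<times> (real^'n) \<times> (real^'n) \<times> real.
      transpose (fst q) - fst q)"
  define h where "h = (\<lambda>q :: (real^'k^'k) \<times> (real^'n) \<times> (real^'n) \<times> real.
      (fst (snd (snd q)), fst q))"
  have eq: "lifted_set Z F = (\<Inter>a. \<Inter>b. f a b -` {0..}) \<inter> g -` {0} \<inter> h -` P_poly Z F"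
    unfolding lifted_set_def psd_bordered_iff f_def g_def h_def by auto
  have f: "linear (f a b)" for a b
    by (rule linearI)
      (simp_all add: f_def matrix_vector_mult_add_rdistrib matrix_vector_right_distrib
        inner_add_right matrix_vector_mult_scaleR scaleR_matrix_vector_assoc[symmetric]
        algebra_simps del: transpose_matrix_vector)
  have g: "linear g"
    by (rule linearI) (simp_all add: g_def vec_eq_iff transpose_def algebra_simps)
  have h: "linear h"
    by (rule linearI) (simp_all add: h_def)
  note cont = linear_continuous_on[OF linear_conv_bounded_linear[THEN iffD1]]
  have P: "closed (P_poly Z F)" "convex (P_poly Z F)"
    by (simp_all add: compact_imp_closed compact_P_poly) (simp add: P_poly_def)
  show "closed (lifted_set Z F)"
    unfolding eq
    by (intro closed_Int closed_INT ballI closed_vimage cont f g h P closed_atLeast closed_singleton)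
  show "convex (lifted_set Z F)"
    unfolding eq
    by (intro convex_Int convex_INT convex_linear_vimage f g h P convex_real_interval
        convex_singleton)
qed

lemma snd_lifted_set_closed_convex:
  fixes F :: "real^'k^'n"
  shows "closed (snd ` lifted_set Z F)" and "convex (snd ` lifted_set Z F)"
proof -
  have "compact (snd ` P_poly Z F)"
    by (intro compact_continuous_image compact_P_poly continuous_on_snd continuous_on_id)
  then have "closed {p. \<exists>W. W \<in> snd ` P_poly Z F \<and> (W, p) \<in> lifted_set Z F}"
    using lifted_set_closed_convex(1) by (rule closed_compact_projection)
  moreover have "snd ` lifted_set Z F = {p. \<exists>W. W \<in> snd ` P_poly Z F \<and> (W, p) \<in> lifted_set Z F}"
    by (force simp: lifted_set_def)
  ultimately show "closed (snd ` lifted_set Z F)" by simp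
  show "convex (snd ` lifted_set Z F)"
    by (intro convex_linear_image linear_snd lifted_set_closed_convex)
qed

section \<open>Points of the mixed-integer set\<close>

lemma inner_gram:
  fixes F :: "real^'k^'n"
  shows "x \<bullet> ((F ** transpose F) *v x) = (transpose F *v x) \<bullet> (transpose F *v x)"
  unfolding matrix_vector_mul_assoc[symmetric] by (rule inner_matrix_vector_transpose)

lemma support_iff: "x * (1 - ind_vec S) = 0 \<longleftrightarrow> ind_vec S * x = x"
  by (auto simp: vec_eq_iff ind_vec_def)

lemma X_setI:
  assumes "ind_vec S \<in> Z" "ind_vec S * x = x" "(transpose F *v x) \<bullet> (transpose F *v x) \<le> t"
  shows "(x, ind_vec S, t) \<in> X_set Z (F ** transpose F)"
  using assms by (simp add: X_set_def inner_gram support_iff del: vector_transpose_matrix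
      transpose_matrix_vector)

lemma X_set_subset_lifted:
  fixes F :: "real^'k^'n"
  assumes Z: "Z \<subseteq> {z. \<forall>i. z $ i \<in> {0, 1}}"
  shows "X_set Z (F ** transpose F) \<subseteq> snd ` lifted_set Z F"
proof clarify
  fix x z t
  assume X: "(x, z, t) \<in> X_set Z (F ** transpose F)"
  define S where "S = {i. z $ i = 1}"
  have zZ: "z \<in> Z" using X by (simp add: X_set_def)
  with Z have "z $ i = 0 \<or> z $ i = 1" for i by auto
  then have z: "z = ind_vec S"
    by (auto simp: S_def ind_vec_def vec_eq_iff)
  have sup: "ind_vec S * x = x"
    using X by (simp add: X_set_def z flip: support_iff)
  let ?u = "transpose F *v x" and ?P = "pinv (F_hat F S) ** F_hat F S"
  have "?P *v ?u = ?u"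
    using pinv_mult_self_transpose[of "F_hat F S" x]
    unfolding transpose_F_hat_mult_vec sup .
  moreover have "?u \<bullet> ?u \<le> t"
    using X unfolding X_set_def by (simp only: mem_Collect_eq prod.case inner_gram)
  ultimately have "psd (bordered ?P ?u ?u t)"
    by (intro psd_bordered_projection transpose_pinv_mult_self pinv_mult_self_idem)
  moreover have "(z, ?P) \<in> P_poly Z F"
    unfolding P_poly_def z by (rule hull_inc) (use zZ z in auto)
  ultimately have "(?P, x, z, t) \<in> lifted_set Z F"
    by (simp only: lifted_set_def mem_Collect_eq prod.case)
  then show "(x, z, t) \<in> snd ` lifted_set Z F"
    by force
qed

text \<open>With \<open>y\<close> and the slack \<open>t - y \<bullet> (W *v y)\<close> fixed, the conditions on \<open>x\<close> are affine jointly in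
  \<open>x\<close>, \<open>z\<close> and \<open>W\<close>, so it suffices to find \<open>x\<close> at the vertices of \<open>P_poly Z F\<close>.\<close>

lemma P_poly_lift:
  fixes F :: "real^'k^'n" and y :: "real^'k"
  assumes "(z, W) \<in> P_poly Z F" and t: "y \<bullet> (W *v y) \<le> t"
  obtains x where "(x, z, t) \<in> convex hull (X_set Z (F ** transpose F))"
    and "transpose F *v x = W *v y"
proof -
  let ?H = "convex hull (X_set Z (F ** transpose F))"
  define s where "s = t - y \<bullet> (W *v y)"
  then have s: "0 \<le> s" using t by simp
  let ?C = "{(z, W). \<exists>x. (x, z, y \<bullet> (W *v y) + s) \<in> ?H \<and> transpose F *v x = W *v y}"
  have "P_poly Z F \<subseteq> ?C"
    unfolding P_poly_def
  proof (rule hull_minimal)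
    show "{(ind_vec S, pinv (F_hat F S) ** F_hat F S) | S. ind_vec S \<in> Z} \<subseteq> ?C"
    proof clarify
      fix S assume S: "(ind_vec S :: real^'n) \<in> Z"
      let ?P = "pinv (F_hat F S) ** F_hat F S"
      define x where "x = ind_vec S * (transpose (pinv (F_hat F S)) *v y)"
      have Fx: "transpose F *v x = ?P *v y"
        unfolding x_def transpose_F_hat_mult_vec[symmetric] by (simp only: pinv_mult_self_range)
      have "y \<bullet> (?P *v y) = y \<bullet> (?P *v (?P *v y))"
        by (simp only: pinv_mult_self_idem)
      also have "\<dots> = (?P *v y) \<bullet> (?P *v y)"
        using inner_matrix_vector_transpose[of y ?P "?P *v y"]
        by (simp only: transpose_pinv_mult_self)
      finally have "(transpose F *v x) \<bullet> (transpose F *v x) \<le> y \<bullet> (?P *v y) + s"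
        unfolding Fx using s by simp
      moreover have "ind_vec S * x = x"
        by (auto simp: x_def ind_vec_def vec_eq_iff)
      ultimately have "(x, ind_vec S, y \<bullet> (?P *v y) + s) \<in> ?H"
        by (intro hull_inc X_setI S)
      with Fx show "\<exists>x. (x, ind_vec S, y \<bullet> (?P *v y) + s) \<in> ?H \<and> transpose F *v x = ?P *v y"
        by blast
    qed
    show "convex ?C"
    proof (rule convexI)
      fix v w and p q :: real
      assume v: "v \<in> ?C" and w: "w \<in> ?C" and pq: "0 \<le> p" "0 \<le> q" "p + q = 1"
      obtain z1 W1 x1 where vz: "v = (z1, W1)"
        and 1: "(x1, z1, y \<bullet> (W1 *v y) + s) \<in> ?H" "transpose F *v x1 = W1 *v y"
        using v by blast
      obtain z2 W2 x2 where wz: "w = (z2, W2)"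
        and 2: "(x2, z2, y \<bullet> (W2 *v y) + s) \<in> ?H" "transpose F *v x2 = W2 *v y"
        using w by blast
      have W: "(p *\<^sub>R W1 + q *\<^sub>R W2) *v y = p *\<^sub>R (W1 *v y) + q *\<^sub>R (W2 *v y)"
        by (simp add: matrix_vector_mult_add_rdistrib scaleR_matrix_vector_assoc)
      have "p * s + q * s = s"
        using pq(3) by (metis distrib_right mult_1)
      then have ps: "p * (v + s) + q * (w + s) = p * v + q * w + s" for v w
        by (simp add: distrib_left)
      have "p *\<^sub>R (x1, z1, y \<bullet> (W1 *v y) + s) + q *\<^sub>R (x2, z2, y \<bullet> (W2 *v y) + s) \<in> ?H"
        using 1(1) 2(1) pq by (intro convexD convex_convex_hull)
      moreover have "transpose F *v (p *\<^sub>R x1 + q *\<^sub>R x2) = (p *\<^sub>R W1 + q *\<^sub>R W2) *v y"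
        unfolding W matrix_vector_right_distrib matrix_vector_mult_scaleR 1(2) 2(2) ..
      ultimately show "p *\<^sub>R v + q *\<^sub>R w \<in> ?C"
        by (auto simp: vz wz W inner_add_right ps simp del: transpose_matrix_vector
            intro!: exI[of _ "p *\<^sub>R x1 + q *\<^sub>R x2"])
    qed
  qed
  moreover have "t = y \<bullet> (W *v y) + s" by (simp add: s_def)
  ultimately show thesis using assms(1) that by blast
qed

section \<open>Recession directions of the closed convex hull\<close>

text \<open>The vectors supported on \<open>S\<close> that are killed by the transpose of \<open>F\<close>.\<close>

definition supported_kernel :: "real^'k^'n \<Rightarrow> 'n set \<Rightarrow> (real^'n) set" where
  "supported_kernel F S = {d. ind_vec S * d = d \<and> transpose F *v d = 0}"

lemma supported_kernel_scaleR: "d \<in> supported_kernel F S \<Longrightarrow> c *\<^sub>R d \<in> supported_kernel F S"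
  unfolding supported_kernel_def mem_Collect_eq matrix_vector_mult_scaleR
  by (metis mult_scaleR_right scaleR_zero_right)

text \<open>The point \<open>p + (d, 0, 0)\<close> is the limit of convex combinations of \<open>p\<close>, with weight \<open>1 - \<epsilon>\<close>,
  and the point \<open>((1 / \<epsilon>) *\<^sub>R d, ind_vec S, 0)\<close> of \<open>X_set Z (F ** transpose F)\<close>, with weight
  \<open>\<epsilon>\<close>, as \<open>\<epsilon>\<close> tends to zero.\<close>

lemma supported_kernel_recession:
  fixes F :: "real^'k^'n" and Z :: "(real^'n) set"
  defines "C \<equiv> closure (convex hull (X_set Z (F ** transpose F)))"
  assumes S: "ind_vec S \<in> Z" and d: "d \<in> supported_kernel F S" and p: "p \<in> C"
  shows "p + (d, 0, 0) \<in> C"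
proof -
  define e where "e n = 1 / real (Suc n)" for n
  have e: "0 < e n" "e n \<le> 1" for n
    by (simp_all add: e_def)
  have e0: "e \<longlonglongrightarrow> 0"
    unfolding e_def using LIMSEQ_inverse_real_of_nat by (simp add: inverse_eq_divide)
  let ?v = "\<lambda>n. (1 - e n) *\<^sub>R p + e n *\<^sub>R ((1 / e n) *\<^sub>R d, ind_vec S, 0)"
  have "?v n \<in> C" for n
  proof -
    have "(1 / e n) *\<^sub>R d \<in> supported_kernel F S"
      using d by (rule supported_kernel_scaleR)
    then have "((1 / e n) *\<^sub>R d, ind_vec S, 0) \<in> X_set Z (F ** transpose F)"
      unfolding supported_kernel_def by (intro X_setI S) auto
    then have "((1 / e n) *\<^sub>R d, ind_vec S, 0) \<in> C"
      unfolding C_def by (intro subsetD[OF closure_subset] hull_inc)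
    with p show ?thesis
      using e[of n] by (intro convexD[of C]) (simp_all add: C_def convex_closure)
  qed
  moreover have "?v \<longlonglongrightarrow> p + (d, 0, 0)"
  proof -
    have "?v n = (1 - e n) *\<^sub>R p + (d, e n *\<^sub>R ind_vec S, 0)" for n
      using e(1)[of n] by simp
    moreover have "(\<lambda>n. (1 - e n) *\<^sub>R p + (d, e n *\<^sub>R ind_vec S, 0))
        \<longlonglongrightarrow> (1 - 0) *\<^sub>R p + (d, 0 *\<^sub>R ind_vec S, 0)"
      by (intro tendsto_intros e0)
    ultimately show ?thesis by simp
  qed
  moreover have "closed C"
    by (simp add: C_def)
  ultimately show ?thesis
    using closed_sequentially[of C ?v] by blast
qed

lemma span_recession:
  fixes F :: "real^'k^'n" and Z :: "(real^'n) set"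
  defines "C \<equiv> closure (convex hull (X_set Z (F ** transpose F)))"
  assumes d: "d \<in> span (\<Union>S\<in>{S. ind_vec S \<in> Z}. supported_kernel F S)" and p: "p \<in> C"
  shows "p + (d, 0, 0) \<in> C"
  using d
proof (induction d rule: span_induct_alt)
  case base
  then show ?case using p by (simp flip: zero_prod_def)
next
  case (step c v w)
  then obtain S where S: "ind_vec S \<in> Z" and v: "v \<in> supported_kernel F S"
    by auto
  have "(p + (w, 0, 0)) + (c *\<^sub>R v, 0, 0) \<in> C"
    using S supported_kernel_scaleR[OF v] step.IH unfolding C_def
    by (rule supported_kernel_recession)
  then show ?case
    by (simp add: ac_simps)
qed

lemma proj_mem_col_on_iff:
  "proj S x \<in> col_on S (row_submatrix F S) \<longleftrightarrow> (\<exists>c. ind_vec S * x = F_hat F S *v c)"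
proof -
  have "proj S x = (\<lambda>i\<in>S. \<Sum>j\<in>UNIV. f j * row_submatrix F S i $ j) \<longleftrightarrow>
      ind_vec S * x = F_hat F S *v (\<chi> j. f j)" for f
    by (auto simp: proj_def row_submatrix_def fun_eq_iff restrict_def vec_eq_iff F_hat_def
        zero_fill_def ind_vec_def matrix_vector_mult_def mult.commute)
  then show ?thesis
    unfolding col_on_def by (auto, metis vec_nth_inverse)
qed

text \<open>Dual form of the hypothesis on the column space: a vector orthogonal to all the supported
  kernels lies in each preimage on the right, hence in the column space.\<close>

lemma kernel_subset_span:
  fixes F :: "real^'k^'n"
  assumes col: "span (columns F) =
           (\<Inter>S\<in>{S. ind_vec S \<in> Z}. proj S -` col_on S (row_submatrix F S))"
    and d: "transpose F *v d = 0"
  shows "d \<in> span (\<Union>S\<in>{S. ind_vec S \<in> Z}. supported_kernel F S)"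
proof -
  let ?M = "\<Union>S\<in>{S. ind_vec S \<in> Z}. supported_kernel F S"
  obtain y z where y: "y \<in> span ?M" and z: "\<And>w. w \<in> span ?M \<Longrightarrow> orthogonal z w"
    and dyz: "d = y + z"
    using orthogonal_subspace_decomp_exists[of ?M d] by blast
  have "proj S z \<in> col_on S (row_submatrix F S)" if S: "ind_vec S \<in> Z" for S
  proof -
    let ?A = "F_hat F S"
    have sp: "span (range ((*v) ?A)) = range ((*v) ?A)"
      by (simp add: linear_subspace_image span_eq_iff)
    obtain c b where b: "\<And>w. w \<in> range ((*v) ?A) \<Longrightarrow> orthogonal b w"
      and zb: "ind_vec S * z = ?A *v c + b"
      using orthogonal_subspace_decomp_exists[of "range ((*v) ?A)" "ind_vec S * z"]
      unfolding sp by blast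
    \<comment> \<open>The residual \<open>b\<close>, restricted to \<open>S\<close>, is a supported kernel vector, so \<open>z\<close> is orthogonal to it.\<close>
    have bA: "b \<bullet> (?A *v w) = 0" for w
      using b by (auto simp: orthogonal_def)
    then have "(transpose ?A *v b) \<bullet> w = 0" for w
      by (simp only: inner_matrix_vector_transpose)
    then have "transpose F *v (ind_vec S * b) = 0"
      unfolding transpose_F_hat_mult_vec using inner_eq_zero_iff by blast
    moreover have "ind_vec S * (ind_vec S * b) = ind_vec S * b"
      by (auto simp: vec_eq_iff ind_vec_def)
    ultimately have "ind_vec S * b \<in> ?M"
      using S by (auto simp: supported_kernel_def)
    then have "z \<bullet> (ind_vec S * b) = 0"
      using z[OF span_base] by (simp only: orthogonal_def)
    then have "b \<bullet> (?A *v c + b) = 0"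
      by (metis zb inner_ind_vec_mult inner_commute)
    then have "b = 0"
      by (simp add: inner_add_right bA)
    with zb show ?thesis
      by (auto simp: proj_mem_col_on_iff)
  qed
  then have "z \<in> span (columns F)"
    unfolding col by auto
  moreover have "span (columns F) \<subseteq> range ((*v) F)"
    by (rule span_minimal) (auto simp: columns_image_basis linear_subspace_image)
  ultimately obtain c where c: "z = F *v c"
    by blast
  have "d \<bullet> z = 0"
    unfolding c inner_matrix_vector_transpose d by simp
  moreover have "y \<bullet> z = 0"
    using z[OF y] by (simp add: orthogonal_def inner_commute)
  ultimately have "z = 0"
    by (simp add: dyz inner_add_left)
  with y dyz show ?thesis by simp
qed

section \<open>The closed convex hull\<close>

theorem theorem2:
  fixes Z :: "(real^'n) set"
    and F :: "real^'k^'n"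
    and Q :: "real^'n^'n"
  assumes "Z \<subseteq> {z. \<forall>i. z $ i \<in> {0, 1}}"
    and "Q = F ** transpose F"
    and "rank F = CARD('k)"
    and "span (columns F) =
           (\<Inter>S\<in>{S. ind_vec S \<in> Z}. proj S -` col_on S (row_submatrix F S))"
  shows "closure (convex hull (X_set Z Q)) =
           {(x, z, t). (\<forall>i. z $ i \<in> {0..1}) \<and>
              (\<exists>W. psd (bordered W (transpose F *v x) (x v* F) t) \<and> (z, W) \<in> P_poly Z F)}"
proof -
  let ?C = "closure (convex hull (X_set Z Q))"
  have "?C = snd ` lifted_set Z F"
  proof (rule equalityI)
    show "?C \<subseteq> snd ` lifted_set Z F"
      unfolding assms(2)
      by (intro closure_minimal hull_minimal X_set_subset_lifted assms(1)
          snd_lifted_set_closed_convex)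
    show "snd ` lifted_set Z F \<subseteq> ?C"
    proof clarsimp
      fix x z t W
      assume L: "(W, x, z, t) \<in> lifted_set Z F"
      let ?u = "transpose F *v x"
      have psd: "psd (bordered W ?u ?u t)" and P: "(z, W) \<in> P_poly Z F"
        using L unfolding lifted_set_def by auto
      obtain y where y: "?u = W *v y" "y \<bullet> (W *v y) \<le> t"
        using bordered_psd_range[OF psd] .
      obtain x' where x': "(x', z, t) \<in> convex hull (X_set Z Q)"
        and Fx': "transpose F *v x' = W *v y"
        using P_poly_lift[OF P y(2)] unfolding assms(2) by blast
      have "transpose F *v (x - x') = 0"
        by (simp only: matrix_vector_mult_diff_distrib y(1) Fx' diff_self)
      then have "x - x' \<in> span (\<Union>S\<in>{S. ind_vec S \<in> Z}. supported_kernel F S)"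
        by (rule kernel_subset_span[OF assms(4)])
      moreover have "(x', z, t) \<in> ?C"
        using x' closure_subset by blast
      ultimately have "(x', z, t) + (x - x', 0, 0) \<in> ?C"
        unfolding assms(2) by (rule span_recession)
      then show "(x, z, t) \<in> ?C"
        by simp
    qed
  qed
  also have "snd ` lifted_set Z F = {(x, z, t). (\<forall>i. z $ i \<in> {0..1}) \<and>
              (\<exists>W. psd (bordered W (transpose F *v x) (x v* F) t) \<and> (z, W) \<in> P_poly Z F)}"
    using P_poly_box unfolding lifted_set_def by force
  finally show ?thesis .
qed

end
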